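(* For all $n\geq 1$, $$\sum_{\sigma\in\mathcal E_{2n}}z^{\mathrm{cyc}\,\sigma}=\sum_{\sigma\in\mathfrak D_{2n}}z^{\mathrm{cyc}\,\sigma}.$$ Consequently $|\mathcal{EC}_{2n}|=|\mathfrak D\mathcal C_{2n}|=G_{2n}$.
   Context: $\mathfrak S_{2n}$ is the set of permutations of $[2n]=\{1,\dots,2n\}$ and $\mathrm{cyc}\,\sigma$ is the number of cycles of $\sigma$ (fixed points included). $\sigma\in\mathfrak S_{2n}$ is a D-permutation if $i\le\sigma(i)$ whenever $i$ is odd and $i\ge\sigma(i)$ whenever $i$ is even. $\sigma\in\mathfrak S_{2n}$ is an E-permutation if $i>\sigma(i)$ implies that $i$ is even and $\sigma(i)$ is odd. $\mathfrak D_{2n}$ and $\mathcal E_{2n}$ are the sets of D-permutations and E-permutations on $[2n]$; $\mathfrak D\mathcal C_{2n}$ and $\mathcal{EC}_{2n}$ are their subsets of permutations consisting of a single cycle (of length $2n$). The Genocchi numbers $G_{2n}$ are defined by $\sum_{n\ge1}G_{2n}\frac{x^{2n}}{(2n)!}=x\tan\frac x2$ (so $G_2=1,G_4=1,G_6=3,G_8=17$). *)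

theory Defs
  imports
    "HOL-Combinatorics.Orbits"
    "HOL-Computational_Algebra.Computational_Algebra"
begin

text \<open>Permutations of \<open>[2n]\<close> are functions on \<^typ>\<open>nat\<close> that permute \<open>{1..2*n}\<close> and are the
  identity elsewhere. All sets below are indexed by \<open>n\<close>, not by \<open>2n\<close>.\<close>

definition D_permutations :: "nat \<Rightarrow> (nat \<Rightarrow> nat) set" where
  "D_permutations n = {\<sigma>. \<sigma> permutes {1..2*n} \<and>
     (\<forall>i\<in>{1..2*n}. (odd i \<longrightarrow> i \<le> \<sigma> i) \<and> (even i \<longrightarrow> i \<ge> \<sigma> i))}"

definition E_permutations :: "nat \<Rightarrow> (nat \<Rightarrow> nat) set" where
  "E_permutations n = {\<sigma>. \<sigma> permutes {1..2*n} \<and>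
     (\<forall>i\<in>{1..2*n}. i > \<sigma> i \<longrightarrow> even i \<and> odd (\<sigma> i))}"

definition D_cycles :: "nat \<Rightarrow> (nat \<Rightarrow> nat) set" where
  "D_cycles n = {\<sigma> \<in> D_permutations n. cyclic_on \<sigma> {1..2*n}}"

definition E_cycles :: "nat \<Rightarrow> (nat \<Rightarrow> nat) set" where
  "E_cycles n = {\<sigma> \<in> E_permutations n. cyclic_on \<sigma> {1..2*n}}"

text \<open>Cycles are counted as orbits; only orbits of points of \<open>A\<close> are counted, since all points
  outside \<open>A\<close> are fixed by a permutation of \<open>A\<close>.\<close>

definition cyc :: "'a set \<Rightarrow> ('a \<Rightarrow> 'a) \<Rightarrow> nat" where
  "cyc A \<sigma> = card (orbit \<sigma> ` A)"

text \<open>Here \<open>fps_tan c\<close> is the power series of \<open>tan (c * x)\<close>. The argument of \<open>genocchi\<close> is the full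
  subscript: \<open>genocchi (2 * n)\<close> is the number written \<open>G\<close> with subscript \<open>2n\<close>.\<close>

definition genocchi :: "nat \<Rightarrow> rat" where
  "genocchi k = fact k * fps_nth (fps_X * fps_tan (1/2)) k"

lemma genocchi_egf:
  "Abs_fps (\<lambda>k. if even k \<and> k \<ge> 2 then genocchi k / fact k else 0) = fps_X * fps_tan (1/2)"
proof -
  let ?t = "fps_tan (1/2) :: rat fps" and ?m = "- fps_X :: rat fps"
  have s: "fps_sin (1/2) oo ?m = - fps_sin (1/2 :: rat)"
    by (rule fps_ext) (auto simp: fps_compose_uminus' fps_sin_def)
  have c: "fps_cos (1/2) oo ?m = fps_cos (1/2 :: rat)"
    by (rule fps_ext) (auto simp: fps_compose_uminus' fps_cos_def)
  have t: "?t oo ?m = - ?t"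
    unfolding fps_tan_def by (subst fps_divide_compose) (simp_all add: s c fps_divide_uminus)
  have odd_t: "fps_nth ?t k = 0" if "even k" for k
  proof -
    have "fps_nth (?t oo ?m) k = fps_nth ?t k"
      using that by (simp add: fps_compose_uminus')
    with t show ?thesis by simp
  qed
  have odd_coeff: "fps_nth (fps_X * ?t) k = 0" if "\<not> (even k \<and> k \<ge> 2)" for k
    using that odd_t[of "k - 1"] by (cases k) (auto simp: Suc_le_eq)
  show ?thesis
  proof (rule fps_ext)
    fix k
    show "fps_nth (Abs_fps (\<lambda>k. if even k \<and> k \<ge> 2 then genocchi k / fact k else 0)) k =
      fps_nth (fps_X * ?t) k"
      using odd_coeff[of k] by (simp add: genocchi_def del: fps_X_mult_nth fps_mult_fps_X_commute)
  qed
qed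

end

theory Submission
  imports Defs
begin

text \<open>
  Both families are defined by a condition on the pairs \<open>(i, \<sigma> i)\<close> alone, so their cycle
  enumerators are sums of \<open>z ^ cyc \<sigma>\<close> over the permutations compatible with a relation, written
  \<open>cyc_sum S R\<close> below. Such a sum has a row expansion: deleting a point \<open>a\<close> from its cycle
  sends \<open>\<sigma>\<close> to a permutation of the remaining points with the same number of cycles, or one
  fewer if \<open>a\<close> was fixed, and \<open>b = \<sigma> a\<close> inherits the possible predecessors of \<open>a\<close>.

  Delete the points \<open>2n, 2n - 1, \<dots>\<close> in this order. What remains is \<open>{1..m}\<close> with some
  gates, each standing for a contracted path through deleted points. For D-permutations such a
  path is entered from odd points only and may return to any point; for E-permutations it may be
  entered from any point and returns to odd points only. An odd \<open>m\<close> has the same effect in both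
  cases, and an even \<open>m\<close> has effects that correspond under reversal of all arrows. So both
  cases obey the same recursion in \<open>m\<close> and in the number \<open>h\<close> of gates
  (\<open>cyc_sum_gated_path_weight\<close>). Hence the two enumerators are equal.

  For the number of cyclic permutations the coefficient of \<open>z\<close> in this recursion is needed.
  Attach to \<open>h\<close> gates the product \<open>(x - z) (x - z - 1) \<cdots> (x - z - h + 1)\<close>. The recursion then
  turns into two operators on functions of \<open>x\<close>, multiplication by \<open>x\<close> and the difference operator
  \<open>x f (x + 1) - (x - z) f x\<close>, and the enumerator is the value at \<open>x = z\<close> of the \<open>n\<close>-fold
  iterate of their composition on the constant \<open>1\<close>. Splitting off a factor \<open>x\<close> and
  putting \<open>z = 0\<close> leaves Gandhi's recursion
  \<open>b\<^sub>1 = 1\<close>, \<open>b\<^sub>n\<^sub>+\<^sub>1 x = (x + 1)\<^sup>2 b\<^sub>n (x + 1) - x\<^sup>2 b\<^sub>n x\<close>, and the wanted coefficient is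
  \<open>b\<^sub>n 0\<close>.

  That \<open>b\<^sub>n 0\<close> is the Genocchi number comes from the classical expansion
  \<open>x tan (x/2) = (\<Sum>k\<ge>1. k! (k - 1)! S\<^sub>k)\<close> with \<open>S\<^sub>k = (2 sin (x/2))\<^sup>2\<^sup>k / (2k)!\<close>. Since
  \<open>S\<^sub>k'' = S\<^sub>k\<^sub>-\<^sub>1 - k\<^sup>2 S\<^sub>k\<close>, two derivatives act on the coefficient sequence by
  \<open>a\<^sub>k \<mapsto> a\<^sub>k\<^sub>+\<^sub>1 - k\<^sup>2 a\<^sub>k\<close>; after division by \<open>(k!)\<^sup>2\<close> this is Gandhi's recursion again
  (\<open>genocchi_gandhi\<close>).
\<close>

section \<open>Cycle numbers and inserted points\<close>

text \<open>Composing with \<open>transpose a b\<close> puts the new point \<open>a\<close> directly before \<open>b\<close> on the cycle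
  of \<open>b\<close>, so an orbit changes at most by the point \<open>a\<close>.\<close>

lemma orbit_insert_before:
  assumes p: "p permutes S" "finite S" and a: "a \<notin> S" and b: "b \<in> S" and x: "x \<in> S"
  defines "q \<equiv> transpose a b \<circ> p"
  shows "orbit q x - {a} = orbit p x"
proof -
  have pa: "p a = a" using p a by (simp add: permutes_not_in)
  have qa: "q a = b" by (simp add: q_def pa)
  have qy: "q y = (if p y = b then a else p y)" if "y \<in> S" for y
    using that p a by (auto simp: q_def transpose_def permutes_in_image)
  have *: "y \<in> orbit q x \<Longrightarrow> (y \<noteq> a \<longrightarrow> y \<in> orbit p x) \<and> (y = a \<longrightarrow> b \<in> orbit p x)" for y
  proof (induction rule: orbit.induct)
    case base
    show ?case using qy[OF x] a permutes_in_image[OF p(1), of x] x orbit.base[of p x] by auto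
  next
    case (step y)
    show ?case
    proof (cases "y = a")
      case True
      thus ?thesis using step qa a b by auto
    next
      case False
      hence y: "y \<in> orbit p x" using step by blast
      hence "y \<in> S" using permutes_orbit_subset[OF p(1) x] by blast
      thus ?thesis using qy[of y] orbit.step[OF y] permutes_in_image[OF p(1), of y] a by auto
    qed
  qed
  have **: "y \<in> orbit p x \<Longrightarrow> y \<in> orbit q x" for y
  proof (induction rule: orbit.induct)
    case base
    show ?case using qy[OF x] orbit.base[of q x] orbit.step[of a q x] qa by (auto split: if_splits)
  next
    case (step y)
    hence "y \<in> S" using permutes_orbit_subset[OF p(1) x] by blast
    thus ?case using qy[of y] orbit.step[OF step.IH] orbit.step[of a q x] qa by (auto split: if_splits)
  qed
  have "a \<notin> orbit p x" using permutes_orbit_subset[OF p(1) x] a by blast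
  thus ?thesis using * ** by blast
qed

text \<open>Removing \<open>a\<close> from every orbit is a bijection from the new orbits to the old ones: distinct
  orbits stay distinct because each contains a point of \<open>S\<close>.\<close>

lemma cyc_insert_before:
  assumes p: "p permutes S" "finite S" and a: "a \<notin> S" and b: "b \<in> S"
  shows "cyc (insert a S) (transpose a b \<circ> p) = cyc S p"
proof -
  let ?q = "transpose a b \<circ> p"
  have q: "?q permutes insert a S"
    using permutes_compose[of p "insert a S" "transpose a b"] permutes_subset[OF p(1), of "insert a S"]
      permutes_swap_id[of a "insert a S" b] b by auto
  hence perm: "permutation ?q" using p(2) unfolding permutation_permutes by blast
  have "?q a = b" using p a by (simp add: permutes_not_in)
  hence "orbit ?q a = orbit ?q b" using permutation_orbit_step[OF perm, of a] by simp
  hence 1: "orbit ?q ` insert a S = orbit ?q ` S" using b by auto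
  have in_S: "orbit ?q y - {a} = orbit p y" if "y \<in> S" for y
    using orbit_insert_before[OF p a b that] .
  have 2: "(\<lambda>C. C - {a}) ` orbit ?q ` S = orbit p ` S"
    unfolding image_image using in_S by (intro image_cong) auto
  have inj: "inj_on (\<lambda>C. C - {a}) (orbit ?q ` S)"
  proof (rule inj_onI)
    fix C D assume "C \<in> orbit ?q ` S" "D \<in> orbit ?q ` S" and eq: "C - {a} = D - {a}"
    then obtain x y where xy: "x \<in> S" "C = orbit ?q x" "y \<in> S" "D = orbit ?q y" by blast
    have "x \<in> C - {a}" using xy a permutation_self_in_orbit[OF perm] by auto
    hence "x \<in> orbit ?q y" using eq xy by blast
    thus "C = D" unfolding xy
      using cyclic_on_orbit'[OF perm, of y] orbit_cyclic_eq3 by metis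
  qed
  show ?thesis unfolding cyc_def 1 2[symmetric] card_image[OF inj] ..
qed

lemma cyc_insert_fixed:
  assumes p: "p permutes S" "finite S" and a: "a \<notin> S"
  shows "cyc (insert a S) p = Suc (cyc S p)"
proof -
  have "orbit p a = {a}" using p a by (simp add: permutes_not_in orbit_eq_singleton_iff)
  moreover have "{a} \<notin> orbit p ` S" using permutes_orbit_subset[OF p(1)] a by blast
  ultimately show ?thesis using p(2) by (simp add: cyc_def)
qed

lemma cyc_inv:
  assumes "p permutes S" "finite S"
  shows "cyc S (inv p) = cyc S p"
proof -
  have "permutation p" using assms unfolding permutation_permutes by blast
  thus ?thesis by (simp add: cyc_def orbit_inv_eq)
qed

section \<open>Cycle enumerators of relations\<close>

text \<open>This is the permanent of the 0-1 matrix of \<open>R\<close> on \<open>S\<close>, refined by a variable for the number of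
  cycles.\<close>

definition cyc_sum :: "'a set \<Rightarrow> ('a \<Rightarrow> 'a \<Rightarrow> bool) \<Rightarrow> int poly" where
  "cyc_sum S R = (\<Sum>\<sigma> | \<sigma> permutes S \<and> (\<forall>x\<in>S. R x (\<sigma> x)). monom 1 (cyc S \<sigma>))"

abbreviation zvar :: "int poly" where "zvar \<equiv> monom 1 1"

lemma cyc_sum_cong:
  assumes "S = S'" "\<And>x y. x \<in> S \<Longrightarrow> y \<in> S \<Longrightarrow> R x y = R' x y"
  shows "cyc_sum S R = cyc_sum S' R'"
proof -
  have "{\<sigma>. \<sigma> permutes S \<and> (\<forall>x\<in>S. R x (\<sigma> x))} = {\<sigma>. \<sigma> permutes S \<and> (\<forall>x\<in>S. R' x (\<sigma> x))}"
    using assms(2) permutes_in_image by fastforce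
  thus ?thesis unfolding cyc_sum_def assms(1)[symmetric] by simp
qed

lemma cyc_sum_empty [simp]: "cyc_sum {} R = 1"
  by (simp add: cyc_sum_def cyc_def)

lemma cyc_sum_dead_row:
  assumes "a \<in> S" "\<And>y. y \<in> S \<Longrightarrow> \<not> R a y"
  shows "cyc_sum S R = 0"
proof -
  have "{\<sigma>. \<sigma> permutes S \<and> (\<forall>x\<in>S. R x (\<sigma> x))} = {}"
    using assms permutes_in_image by fastforce
  thus ?thesis unfolding cyc_sum_def by (simp only: sum.empty)
qed

text \<open>Inversion preserves orbits and transposes the relation; it turns row expansions into column
  expansions.\<close>

lemma cyc_sum_inverse:
  assumes "finite S"
  shows "cyc_sum S (\<lambda>x y. R y x) = cyc_sum S R"
proof -
  have inv: "inv \<sigma> permutes S \<and> (\<forall>x\<in>S. R' x (inv \<sigma> x))"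
    if "\<sigma> permutes S" "\<forall>x\<in>S. R' (\<sigma> x) x" for \<sigma> R'
  proof (intro conjI ballI)
    show "inv \<sigma> permutes S" using that permutes_inv by blast
    fix x assume "x \<in> S"
    hence "inv \<sigma> x \<in> S" using \<open>inv \<sigma> permutes S\<close> permutes_in_image by fastforce
    hence "R' (\<sigma> (inv \<sigma> x)) (inv \<sigma> x)" using that by blast
    thus "R' x (inv \<sigma> x)" using that permutes_inverses by fastforce
  qed
  show ?thesis unfolding cyc_sum_def
    by (rule sum.reindex_bij_witness[where i = inv and j = inv])
       (use inv[where R' = R] inv[where R' = "\<lambda>x y. R y x"] assms in \<open>auto simp: permutes_inv_inv cyc_inv\<close>)
qed

text \<open>The summands sort the permutations by the image of \<open>a\<close>. If \<open>a\<close> is fixed it is a cycle of its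
  own. If it is sent to \<open>b\<close>, delete it: the predecessor of \<open>a\<close> becomes that of \<open>b\<close>, so column
  \<open>b\<close> of the relation is replaced by column \<open>a\<close>.\<close>

lemma cyc_sum_expand_row:
  assumes S: "finite S" "a \<notin> S"
  shows "cyc_sum (insert a S) R = (if R a a then zvar * cyc_sum S R else 0) +
    (\<Sum>b | b \<in> S \<and> R a b. cyc_sum S (\<lambda>x y. R x (if y = b then a else y)))"
proof -
  let ?R = "\<lambda>b x y. R x (if y = b then a else y)"
  have fin: "finite {\<sigma>. \<sigma> permutes S}" using S by (simp add: finite_permutations)
  have "cyc_sum (insert a S) R = (\<Sum>\<sigma> | \<sigma> permutes insert a S.
     if (\<forall>x\<in>insert a S. R x (\<sigma> x)) then monom 1 (cyc (insert a S) \<sigma>) else 0)"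
    unfolding cyc_sum_def using S
    by (subst sum.inter_filter[symmetric]) (auto simp: finite_permutations)
  also have "\<dots> = (\<Sum>b\<in>insert a S. \<Sum>p | p permutes S.
     if (\<forall>x\<in>insert a S. R x ((transpose a b \<circ> p) x)) then monom 1 (cyc (insert a S) (transpose a b \<circ> p)) else 0)"
    by (rule sum_over_permutations_insert[OF S])
  also have "\<dots> = (\<Sum>p | p permutes S.
     if (\<forall>x\<in>insert a S. R x ((transpose a a \<circ> p) x)) then monom 1 (cyc (insert a S) (transpose a a \<circ> p)) else 0) +
     (\<Sum>b\<in>S. \<Sum>p | p permutes S.
     if (\<forall>x\<in>insert a S. R x ((transpose a b \<circ> p) x)) then monom 1 (cyc (insert a S) (transpose a b \<circ> p)) else 0)"
    using S by simp
  also have "(\<Sum>p | p permutes S.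
     if (\<forall>x\<in>insert a S. R x ((transpose a a \<circ> p) x)) then monom 1 (cyc (insert a S) (transpose a a \<circ> p)) else 0)
     = (\<Sum>p | p permutes S. if R a a then zvar * (if \<forall>x\<in>S. R x (p x) then monom 1 (cyc S p) else 0) else 0)"
    using S by (intro sum.cong) (auto simp: permutes_not_in cyc_insert_fixed mult_monom)
  also have "\<dots> = (if R a a then zvar * cyc_sum S R else 0)"
    unfolding cyc_sum_def using fin
    by (simp add: sum_distrib_left[symmetric] sum.inter_filter[symmetric])
  also have "(\<Sum>b\<in>S. \<Sum>p | p permutes S.
     if (\<forall>x\<in>insert a S. R x ((transpose a b \<circ> p) x)) then monom 1 (cyc (insert a S) (transpose a b \<circ> p)) else 0)
    = (\<Sum>b\<in>S. if R a b then cyc_sum S (?R b) else 0)"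
  proof (rule sum.cong[OF refl])
    fix b assume b: "b \<in> S"
    have "(\<Sum>p | p permutes S.
       if (\<forall>x\<in>insert a S. R x ((transpose a b \<circ> p) x)) then monom 1 (cyc (insert a S) (transpose a b \<circ> p)) else 0)
      = ((\<Sum>p | p permutes S. if R a b then if (\<forall>x\<in>S. ?R b x (p x)) then monom 1 (cyc S p) else 0 else 0) :: int poly)"
    proof (rule sum.cong[OF refl])
      fix p assume "p \<in> {p. p permutes S}"
      hence p: "p permutes S" by simp
      have pa: "p a = a" using p S by (simp add: permutes_not_in)
      have px: "transpose a b (p x) = (if p x = b then a else p x)" if "x \<in> S" for x
        using p S(2) that by (auto simp: transpose_def permutes_in_image)
      show "(if (\<forall>x\<in>insert a S. R x ((transpose a b \<circ> p) x)) then monom 1 (cyc (insert a S) (transpose a b \<circ> p)) else 0)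
        = (if R a b then if (\<forall>x\<in>S. ?R b x (p x)) then monom 1 (cyc S p) else 0 else (0 :: int poly))"
        unfolding cyc_insert_before[OF p S b] using px by (auto simp: pa)
    qed
    also have "\<dots> = (if R a b then cyc_sum S (?R b) else 0)"
      unfolding cyc_sum_def using fin by (simp add: sum.inter_filter[symmetric])
    finally show "(\<Sum>p | p permutes S.
       if (\<forall>x\<in>insert a S. R x ((transpose a b \<circ> p) x)) then monom 1 (cyc (insert a S) (transpose a b \<circ> p)) else 0)
      = (if R a b then cyc_sum S (?R b) else 0)" .
  qed
  also have "\<dots> = (\<Sum>b | b \<in> S \<and> R a b. cyc_sum S (?R b))"
    using S by (simp add: sum.inter_filter)
  finally show ?thesis .
qed

lemma cyc_sum_expand_column:
  assumes S: "finite S" "a \<notin> S"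
  shows "cyc_sum (insert a S) R = (if R a a then zvar * cyc_sum S R else 0) +
    (\<Sum>b | b \<in> S \<and> R b a. cyc_sum S (\<lambda>x y. R (if x = b then a else x) y))"
proof -
  have "cyc_sum (insert a S) R = cyc_sum (insert a S) (\<lambda>x y. R y x)"
    using S by (subst cyc_sum_inverse) auto
  also have "\<dots> = (if R a a then zvar * cyc_sum S (\<lambda>x y. R y x) else 0) +
    (\<Sum>b | b \<in> S \<and> R b a. cyc_sum S (\<lambda>x y. R (if y = b then a else y) x))"
    by (rule cyc_sum_expand_row[OF S])
  also have "cyc_sum S (\<lambda>x y. R y x) = cyc_sum S R"
    by (rule cyc_sum_inverse[OF S(1)])
  also have "(\<lambda>b. cyc_sum S (\<lambda>x y. R (if y = b then a else y) x)) = (\<lambda>b. cyc_sum S (\<lambda>x y. R (if x = b then a else x) y))"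
    by (rule ext) (rule cyc_sum_inverse[OF S(1)])
  finally show ?thesis .
qed

section \<open>Deleting points from the right\<close>

text \<open>The points of \<open>X\<close> act as gates, which stand for contracted paths through deleted points: they are
  entered from \<open>I\<close> and left to \<open>J\<close>. Consecutive deleted points lie on one path, so no arrow
  leads from a gate to a gate.\<close>

definition gated :: "'a set \<Rightarrow> 'a set \<Rightarrow> ('a \<Rightarrow> 'a \<Rightarrow> bool) \<Rightarrow> 'a set \<Rightarrow> 'a \<Rightarrow> 'a \<Rightarrow> bool" where
  "gated I J R X x y \<longleftrightarrow>
     (if x \<in> X then y \<notin> X \<and> y \<in> J else if y \<in> X then x \<in> I else R x y)"

lemma gated_converse: "gated I J R X y x = gated J I (\<lambda>x y. R y x) X x y"
  by (auto simp: gated_def)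

lemma cyc_sum_gated_empty:
  "cyc_sum X (gated I J R X) = (if X = {} then 1 else 0)"
proof (cases "X = {}")
  case False
  then obtain a where "a \<in> X" by blast
  thus ?thesis using False by (auto intro!: cyc_sum_dead_row[of a] simp: gated_def)
qed simp

text \<open>The point \<open>m\<close> differs from a further gate only in that it may also be fixed or be followed by a
  gate of \<open>X\<close>. Both sums are therefore expanded along row \<open>m\<close>: the terms with target in \<open>L\<close>
  agree, the fixed point contributes the variable, and a gate reached from \<open>m\<close> keeps its
  predecessors, because \<open>m\<close> and the gates have the same ones.\<close>

lemma cyc_sum_gated_open_row:
  assumes fin: "finite L" "finite X" and disj: "L \<inter> X = {}" "m \<notin> L" "m \<notin> X"
      and m: "R m m" "m \<in> I" "m \<notin> J"
      and col: "\<And>x. x \<in> L \<Longrightarrow> R x m \<longleftrightarrow> x \<in> I"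
      and row: "\<And>y. y \<in> L \<Longrightarrow> R m y \<longleftrightarrow> y \<in> J"
  shows "cyc_sum (insert m (L \<union> X)) (gated I J R X) =
           (zvar + of_nat (card X)) * cyc_sum (L \<union> X) (gated I J R X)
           + cyc_sum (insert m (L \<union> X)) (gated I J R (insert m X))"
proof -
  let ?g = "gated I J R X" and ?g' = "gated I J R (insert m X)"
  let ?redirect = "\<lambda>g b x y. g x (if y = b then m else y)"
  have S: "finite (L \<union> X)" "m \<notin> L \<union> X" using fin disj by auto
  have targets: "{b. b \<in> L \<union> X \<and> ?g m b} = (L \<inter> J) \<union> X"
    using disj m row by (auto simp: gated_def)
  have targets': "{b. b \<in> L \<union> X \<and> ?g' m b} = L \<inter> J"
    using disj m row by (auto simp: gated_def)
  have to_X: "cyc_sum (L \<union> X) (?redirect ?g b) = cyc_sum (L \<union> X) ?g" if "b \<in> X" for b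
    using that disj m col by (intro cyc_sum_cong) (auto simp: gated_def)
  have to_L: "cyc_sum (L \<union> X) (?redirect ?g b) = cyc_sum (L \<union> X) (?redirect ?g' b)" if "b \<in> L" for b
    using that disj m col by (intro cyc_sum_cong) (auto simp: gated_def)
  have "cyc_sum (insert m (L \<union> X)) ?g' = (\<Sum>b\<in>L \<inter> J. cyc_sum (L \<union> X) (?redirect ?g' b))"
    unfolding cyc_sum_expand_row[OF S] targets' by (simp add: gated_def)
  moreover have "cyc_sum (insert m (L \<union> X)) ?g =
      zvar * cyc_sum (L \<union> X) ?g + (\<Sum>b\<in>(L \<inter> J) \<union> X. cyc_sum (L \<union> X) (?redirect ?g b))"
    unfolding cyc_sum_expand_row[OF S] targets using disj m by (simp add: gated_def)
  moreover have "(\<Sum>b\<in>(L \<inter> J) \<union> X. cyc_sum (L \<union> X) (?redirect ?g b)) =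
      (\<Sum>b\<in>L \<inter> J. cyc_sum (L \<union> X) (?redirect ?g' b)) + of_nat (card X) * cyc_sum (L \<union> X) ?g"
    using fin disj by (subst sum.union_disjoint) (auto simp: to_X to_L)
  ultimately show ?thesis by (simp add: algebra_simps)
qed

text \<open>The transposed situation, in which gates may precede \<open>m\<close> but not follow it.\<close>

lemma cyc_sum_gated_open_column:
  assumes fin: "finite L" "finite X" and disj: "L \<inter> X = {}" "m \<notin> L" "m \<notin> X"
      and m: "R m m" "m \<notin> I" "m \<in> J"
      and col: "\<And>x. x \<in> L \<Longrightarrow> R x m \<longleftrightarrow> x \<in> I"
      and row: "\<And>y. y \<in> L \<Longrightarrow> R m y \<longleftrightarrow> y \<in> J"
  shows "cyc_sum (insert m (L \<union> X)) (gated I J R X) =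
           (zvar + of_nat (card X)) * cyc_sum (L \<union> X) (gated I J R X)
           + cyc_sum (insert m (L \<union> X)) (gated I J R (insert m X))"
proof -
  have inverse: "cyc_sum S (gated J I (\<lambda>x y. R y x) Y) = cyc_sum S (gated I J R Y)"
    if "finite S" for S Y
    using cyc_sum_inverse[OF that, of "gated I J R Y"] unfolding gated_converse[of I J R] .
  show ?thesis
    using cyc_sum_gated_open_row[of L X m "\<lambda>x y. R y x" J I] assms by (simp add: inverse)
qed

text \<open>Here \<open>m\<close> is fixed or followed by a gate \<open>j\<close>. Deleting \<open>m\<close> in the second case lets \<open>j\<close> also be
  preceded by any gate, itself included. Sorting by the predecessor of \<open>j\<close> gives three
  contributions: a point of \<open>I\<close>, where \<open>j\<close> is an ordinary gate; \<open>j\<close> itself, which closes a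
  cycle; and one of the other gates, which merges with \<open>j\<close>.\<close>

lemma cyc_sum_gated_join:
  assumes fin: "finite L" "finite X" and disj: "L \<inter> X = {}" "m \<notin> L" "m \<notin> X"
      and m: "R m m" "m \<in> I" "m \<in> J"
      and col: "\<And>x. x \<in> L \<Longrightarrow> R x m \<longleftrightarrow> x \<in> I"
      and row: "\<And>y. y \<in> L \<Longrightarrow> \<not> R m y"
  shows "cyc_sum (insert m (L \<union> X)) (gated I J R X) =
           (zvar + of_nat (card X)) * cyc_sum (L \<union> X) (gated I J R X)
           + (\<Sum>j\<in>X. (zvar + of_nat (card X - 1)) *
                cyc_sum (L \<union> (X - {j})) (gated I J R (X - {j})))"
proof -
  let ?g = "gated I J R X"
  let ?redirect = "\<lambda>j x y. ?g x (if y = j then m else y)"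
  have S: "finite (L \<union> X)" "m \<notin> L \<union> X" using fin disj by auto
  have targets: "{b. b \<in> L \<union> X \<and> ?g m b} = X"
    using disj m row by (auto simp: gated_def)
  have "cyc_sum (insert m (L \<union> X)) ?g =
      zvar * cyc_sum (L \<union> X) ?g + (\<Sum>j\<in>X. cyc_sum (L \<union> X) (?redirect j))"
    unfolding cyc_sum_expand_row[OF S] targets using disj m by (simp add: gated_def)
  moreover have "cyc_sum (L \<union> X) (?redirect j) = cyc_sum (L \<union> X) ?g +
      (zvar + of_nat (card X - 1)) * cyc_sum (L \<union> (X - {j})) (gated I J R (X - {j}))"
    if j: "j \<in> X" for j
  proof -
    let ?S = "L \<union> (X - {j})" and ?g' = "gated I J R (X - {j})"
    let ?from = "\<lambda>g b x y. g (if x = b then j else x) y"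
    have S': "finite ?S" "j \<notin> ?S" and split: "L \<union> X = insert j ?S"
      using fin disj j by auto
    have closed: "\<not> ?g j j"
      using j by (simp add: gated_def)
    have sources: "{b. b \<in> ?S \<and> ?g b j} = L \<inter> I"
      using disj j by (auto simp: gated_def)
    have sources': "{b. b \<in> ?S \<and> ?redirect j b j} = (L \<inter> I) \<union> (X - {j})"
      using disj j m col by (auto simp: gated_def)
    have same: "cyc_sum ?S (?redirect j) = cyc_sum ?S ?g'"
      using disj j by (intro cyc_sum_cong) (auto simp: gated_def)
    have from_X: "cyc_sum ?S (?from (?redirect j) b) = cyc_sum ?S ?g'" if "b \<in> X - {j}" for b
      using that disj j by (intro cyc_sum_cong) (auto simp: gated_def)
    \<comment> \<open>These terms reappear in the expansion of the unmodified sum along column \<open>j\<close>.\<close>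
    have from_L: "cyc_sum ?S (?from (?redirect j) b) = cyc_sum ?S (?from ?g b)" if "b \<in> L" for b
      using that disj j by (intro cyc_sum_cong) auto
    have "cyc_sum (L \<union> X) ?g = (\<Sum>b\<in>L \<inter> I. cyc_sum ?S (?from ?g b))"
      unfolding split cyc_sum_expand_column[OF S'] sources using closed by simp
    moreover have "cyc_sum (L \<union> X) (?redirect j) = zvar * cyc_sum ?S ?g' +
        (\<Sum>b\<in>(L \<inter> I) \<union> (X - {j}). cyc_sum ?S (?from (?redirect j) b))"
      unfolding split cyc_sum_expand_column[OF S'] sources' same
      using j disj m by (simp add: gated_def)
    moreover have "(\<Sum>b\<in>(L \<inter> I) \<union> (X - {j}). cyc_sum ?S (?from (?redirect j) b)) =
        (\<Sum>b\<in>L \<inter> I. cyc_sum ?S (?from ?g b)) + of_nat (card X - 1) * cyc_sum ?S ?g'"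
      using fin disj j by (subst sum.union_disjoint) (auto simp: from_X from_L)
    ultimately show ?thesis by (simp add: algebra_simps)
  qed
  ultimately show ?thesis by (simp add: sum.distrib algebra_simps)
qed

text \<open>The total weight of the lattice paths with \<open>m\<close> steps from height \<open>h\<close> to height \<open>0\<close>. Every step
  may be level; otherwise it goes down if the number of steps left is odd and up if it is even.\<close>

fun path_weight :: "nat \<Rightarrow> nat \<Rightarrow> int poly" where
  "path_weight 0 h = (if h = 0 then 1 else 0)"
| "path_weight (Suc m) h = (zvar + of_nat h) * path_weight m h +
     (if odd (Suc m) then of_nat h * (zvar + of_nat (h - 1)) * path_weight m (h - 1)
      else path_weight m (Suc h))"

text \<open>The hypotheses are what D-permutations and E-permutations have in common. An odd point joins or
  extends gates; an even point can play the role of a gate, up to arrows on one side, and which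
  side depends on whether it lies in \<open>I\<close> or in \<open>J\<close>. Only the number of gates
  matters, which lets the claim be proved for all finite sets \<open>X\<close> at once.\<close>

lemma cyc_sum_gated_path_weight:
  fixes R :: "nat \<Rightarrow> nat \<Rightarrow> bool"
  assumes R: "\<And>m. R m m"
      and col: "\<And>x m. x < m \<Longrightarrow> R x m \<longleftrightarrow> x \<in> I"
      and row_odd: "\<And>m y. odd m \<Longrightarrow> y < m \<Longrightarrow> \<not> R m y"
      and row_even: "\<And>m y. even m \<Longrightarrow> y < m \<Longrightarrow> R m y \<longleftrightarrow> y \<in> J"
      and odds: "\<And>m. odd m \<Longrightarrow> m \<in> I \<and> m \<in> J"
      and evens: "\<And>m. even m \<Longrightarrow> m \<in> I \<longleftrightarrow> m \<notin> J"
      and X: "finite X" "X \<inter> {1..m} = {}"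
  shows "cyc_sum ({1..m} \<union> X) (gated I J R X) = path_weight m (card X)"
  using X
proof (induction m arbitrary: X)
  case 0
  thus ?case by (simp add: cyc_sum_gated_empty)
next
  case (Suc m)
  let ?m = "Suc m"
  have range: "{1..?m} = insert ?m {1..m}" by auto
  have disj: "finite {1..m}" "finite X" "{1..m} \<inter> X = {}" "?m \<notin> {1..m}" "?m \<notin> X"
    using Suc.prems by auto
  have IH: "cyc_sum ({1..m} \<union> X) (gated I J R X) = path_weight m (card X)"
    using Suc.prems by (intro Suc.IH) auto
  show ?case
  proof (cases "odd ?m")
    case True
    have "cyc_sum ({1..m} \<union> (X - {j})) (gated I J R (X - {j})) = path_weight m (card X - 1)"
      if "j \<in> X" for j
    proof -
      have "(X - {j}) \<inter> {1..m} = {}" using Suc.prems by auto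
      thus ?thesis using Suc.IH[of "X - {j}"] Suc.prems that by simp
    qed
    thus ?thesis
      using cyc_sum_gated_join[where R = R and I = I and J = J, OF disj R] odds[OF True] col row_odd[OF True] True
      by (simp add: range IH del: One_nat_def)
  next
    case False
    have "insert ?m X \<inter> {1..m} = {}" using Suc.prems by auto
    hence "cyc_sum (insert ?m ({1..m} \<union> X)) (gated I J R (insert ?m X)) = path_weight m (Suc (card X))"
      using Suc.IH[of "insert ?m X"] disj by simp
    thus ?thesis
      using cyc_sum_gated_open_row[where R = R and I = I and J = J, OF disj R]
        cyc_sum_gated_open_column[where R = R and I = I and J = J, OF disj R]
        evens[of ?m] col row_even[of ?m] False
      by (cases "?m \<in> I") (simp_all add: range IH del: One_nat_def)
  qed
qed

definition D_rel :: "nat \<Rightarrow> nat \<Rightarrow> bool" where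
  "D_rel i j \<longleftrightarrow> (odd i \<longrightarrow> i \<le> j) \<and> (even i \<longrightarrow> i \<ge> j)"

definition E_rel :: "nat \<Rightarrow> nat \<Rightarrow> bool" where
  "E_rel i j \<longleftrightarrow> (i > j \<longrightarrow> even i \<and> odd j)"

text \<open>A larger point is reached only from an odd point, while an even point, which maps downwards, may
  lead to any smaller point. This determines where gates are entered and left.\<close>

lemma D_permutations_path_weight: "(\<Sum>\<sigma>\<in>D_permutations n. monom 1 (cyc {1..2*n} \<sigma>)) = path_weight (2*n) 0"
proof -
  have "(\<Sum>\<sigma>\<in>D_permutations n. monom 1 (cyc {1..2*n} \<sigma>)) = cyc_sum {1..2*n} D_rel"
    unfolding cyc_sum_def D_permutations_def D_rel_def ..
  also have "\<dots> = cyc_sum ({1..2*n} \<union> {}) (gated {i. odd i} UNIV D_rel {})"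
    by (rule cyc_sum_cong) (auto simp: gated_def)
  also have "\<dots> = path_weight (2*n) (card ({} :: nat set))"
    by (rule cyc_sum_gated_path_weight) (auto simp: D_rel_def)
  finally show ?thesis by simp
qed

text \<open>Upward arrows are unrestricted and downward arrows end at odd points, so gates are entered from
  anywhere and left to odd points.\<close>

lemma E_permutations_path_weight: "(\<Sum>\<sigma>\<in>E_permutations n. monom 1 (cyc {1..2*n} \<sigma>)) = path_weight (2*n) 0"
proof -
  have "(\<Sum>\<sigma>\<in>E_permutations n. monom 1 (cyc {1..2*n} \<sigma>)) = cyc_sum {1..2*n} E_rel"
    unfolding cyc_sum_def E_permutations_def E_rel_def ..
  also have "\<dots> = cyc_sum ({1..2*n} \<union> {}) (gated UNIV {i. odd i} E_rel {})"
    by (rule cyc_sum_cong) (auto simp: gated_def)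
  also have "\<dots> = path_weight (2*n) (card ({} :: nat set))"
    by (rule cyc_sum_gated_path_weight) (auto simp: E_rel_def)
  finally show ?thesis by simp
qed

section \<open>The recursion as operators on polynomials\<close>

text \<open>In this basis the two kinds of recursion steps of \<open>path_weight\<close> become simple operators in \<open>x\<close>.
  The shift by the variable makes all basis elements with \<open>h > 0\<close> vanish at \<open>x = zvar\<close>, so that
  evaluation there encodes the initial condition. The argument \<open>x\<close> ranges over polynomials in
  \<open>zvar\<close>, because \<open>zvar\<close> itself is substituted for it.\<close>

definition shifted_falling :: "nat \<Rightarrow> int poly \<Rightarrow> int poly" where
  "shifted_falling h x = (\<Prod>j<h. x - zvar - of_nat j)"

lemma shifted_falling_step_even:
  "x * shifted_falling h x = (zvar + of_nat h) * shifted_falling h x + shifted_falling (Suc h) x"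
  by (simp add: shifted_falling_def algebra_simps)

text \<open>The difference operator lowers the index by the rule of falling factorials, and the
  multiplications by \<open>x\<close> and \<open>x - zvar\<close> raise it again.\<close>

lemma shifted_falling_step_odd:
  "x * shifted_falling h (x + 1) - (x - zvar) * shifted_falling h x =
     (zvar + of_nat h) * shifted_falling h x +
     of_nat h * (zvar + of_nat (h - 1)) * shifted_falling (h - 1) x"
proof (cases h)
  case 0
  thus ?thesis by (simp add: shifted_falling_def)
next
  case (Suc k)
  have up: "shifted_falling (Suc k) (x + 1) = (x + 1 - zvar) * shifted_falling k x"
    unfolding shifted_falling_def prod.lessThan_Suc_shift by (simp add: algebra_simps)
  have down: "shifted_falling (Suc k) x = shifted_falling k x * (x - zvar - of_nat k)"
    by (simp add: shifted_falling_def)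
  show ?thesis unfolding Suc up down by (simp add: algebra_simps)
qed

text \<open>The linear functional that sends the basis element for \<open>h\<close> to \<open>path_weight m h\<close>.\<close>

fun transfer :: "nat \<Rightarrow> (int poly \<Rightarrow> int poly) \<Rightarrow> int poly" where
  "transfer 0 f = f zvar"
| "transfer (Suc m) f = transfer m
     (if odd (Suc m) then (\<lambda>x. x * f (x + 1) - (x - zvar) * f x) else (\<lambda>x. x * f x))"

lemma transfer_linear:
  "transfer m (\<lambda>x. c * f x + d * g x) = c * transfer m f + d * transfer m g"
proof (induction m arbitrary: f g)
  case (Suc m)
  show ?case
    by (simp add: Suc.IH[symmetric] algebra_simps)
qed simp

lemma path_weight_transfer: "path_weight m h = transfer m (shifted_falling h)"
proof (induction m arbitrary: h)
  case 0
  show ?case by (cases h) (auto simp: shifted_falling_def prod.lessThan_Suc_shift)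
next
  case (Suc m)
  have "transfer (Suc m) (shifted_falling h) = transfer m
     (\<lambda>x. (zvar + of_nat h) * shifted_falling h x +
        (if odd (Suc m) then of_nat h * (zvar + of_nat (h - 1)) else 1) *
        shifted_falling (if odd (Suc m) then h - 1 else Suc h) x)"
    by (simp add: shifted_falling_step_odd shifted_falling_step_even del: One_nat_def)
  thus ?case unfolding transfer_linear by (simp add: Suc.IH)
qed

section \<open>Genocchi numbers by Gandhi recursion\<close>

abbreviation sin_half :: "rat fps" where "sin_half \<equiv> fps_sin (1/2)"
abbreviation cos_half :: "rat fps" where "cos_half \<equiv> fps_cos (1/2)"

lemma cos_half_squared: "cos_half^2 = 1 - sin_half^2"
  using fps_sin_cos_sum_of_squares[of "1/2::rat"] by (simp add: algebra_simps)

text \<open>The factors \<open>2\<close> clear the denominators that the chain rule for \<open>x/2\<close> produces.\<close>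

lemma double_deriv_sin: "2 * fps_deriv sin_half = cos_half"
  and double_deriv_cos: "2 * fps_deriv cos_half = - sin_half"
  by (simp_all add: fps_eq_iff fps_sin_deriv fps_cos_deriv numeral_fps_const)

lemma double_deriv_sin_power: "2 * fps_deriv (sin_half^Suc m) = of_nat (Suc m) * sin_half^m * cos_half"
proof -
  have "2 * fps_deriv (sin_half^Suc m) = of_nat (Suc m) * sin_half^m * (2 * fps_deriv sin_half)"
    unfolding fps_deriv_power fps_of_nat[symmetric] by (simp only: mult_ac diff_Suc_1)
  thus ?thesis unfolding double_deriv_sin .
qed

lemma second_deriv_sin_power:
  "4 * fps_deriv (fps_deriv (sin_half^(m+2))) = of_nat ((m+2)*(m+1)) * sin_half^m - of_nat ((m+2)^2) * sin_half^(m+2)"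
proof -
  have "4 * fps_deriv (fps_deriv (sin_half^(m+2))) = 2 * fps_deriv (2 * fps_deriv (sin_half^Suc (Suc m)))"
    by (simp add: fps_deriv_mult del: power_Suc)
  also have "\<dots> = of_nat (m+2) * (2 * fps_deriv (sin_half^Suc m) * cos_half + sin_half^Suc m * (2 * fps_deriv cos_half))"
    unfolding double_deriv_sin_power
    by (simp add: fps_deriv_mult double_deriv_sin_power distrib_left mult_ac del: of_nat_Suc of_nat_add power_Suc)
  also have "\<dots> = of_nat (m+2) * (of_nat (m+1) * sin_half^m * cos_half^2 - sin_half^(m+2))"
    unfolding double_deriv_sin_power double_deriv_cos by (simp add: power2_eq_square algebra_simps)
  also have "\<dots> = of_nat ((m+2)*(m+1)) * sin_half^m - of_nat ((m+2)^2) * sin_half^(m+2)"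
    unfolding cos_half_squared by (simp add: power2_eq_square algebra_simps)
  finally show ?thesis .
qed

text \<open>The series \<open>(2 sin (x/2))\<^sup>2\<^sup>k / (2k)!\<close>, the exponential generating function of the signed
  central factorial numbers.\<close>

definition sin_even_power :: "nat \<Rightarrow> rat fps" where
  "sin_even_power k = fps_const (4^k / fact (2*k)) * sin_half^(2*k)"

lemma sin_even_power_0 [simp]: "sin_even_power 0 = 1"
  by (simp add: sin_even_power_def)

lemma second_deriv_sin_even_power:
  "fps_deriv (fps_deriv (sin_even_power (Suc k))) =
     sin_even_power k - fps_const (of_nat ((Suc k)^2)) * sin_even_power (Suc k)"
proof -
  let ?c = "4^k / fact (2*Suc k) :: rat"
  have c: "fps_const (4^Suc k / fact (2*Suc k)) = fps_const ?c * 4"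
    by (simp add: fps_eq_iff numeral_fps_const)
  have a: "?c * of_nat ((2*k+2)*(2*k+1)) = 4^k / fact (2*k)"
  proof -
    have cancel: "f = N * g \<Longrightarrow> N \<noteq> 0 \<Longrightarrow> p / f * N = p / g" for f N g p :: rat
      by simp
    show ?thesis
    proof (rule cancel)
      show "(fact (2*Suc k) :: rat) = of_nat ((2*k+2)*(2*k+1)) * fact (2*k)"
        by (simp add: algebra_simps)
      show "of_nat ((2*k+2)*(2*k+1)) \<noteq> (0 :: rat)"
        by (simp only: of_nat_eq_0_iff) simp
    qed
  qed
  have "fps_deriv (fps_deriv (sin_even_power (Suc k))) =
      fps_const ?c * (4 * fps_deriv (fps_deriv (sin_half^(2*k+2))))"
    unfolding sin_even_power_def c by (simp add: fps_deriv_mult mult.assoc)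
  also have "\<dots> = fps_const (?c * of_nat ((2*k+2)*(2*k+1))) * sin_half^(2*k) -
       fps_const (?c * of_nat ((2*k+2)^2)) * sin_half^(2*k+2)"
    unfolding second_deriv_sin_power fps_of_nat[symmetric]
    by (simp only: fps_const_mult[symmetric] right_diff_distrib mult.assoc)
  also have "?c * of_nat ((2*k+2)^2) = of_nat ((Suc k)^2) * (4^Suc k / fact (2*Suc k))"
    by (simp add: field_simps power2_eq_square)
  finally show ?thesis unfolding a sin_even_power_def 
    by (simp only: fps_const_mult[symmetric] mult.assoc) simp
qed

text \<open>Multiplying by \<open>sin x = 2 sin (x/2) cos (x/2)\<close> makes the equation polynomial in the sine, so that it
  can be compared with its powers.\<close>

lemma X_tan_half_ode:
  fixes F :: "rat fps"
  defines "F \<equiv> fps_X * fps_tan (1/2)"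
  shows "fps_sin 1 * fps_deriv F - F = 2 * sin_half^2"
proof -
  have C0: "cos_half $ 0 \<noteq> 0" by (simp add: fps_cos_def)
  have t: "fps_tan (1/2) * cos_half = sin_half"
    unfolding fps_tan_def by (rule dvd_div_mult_self[OF unit_imp_dvd]) (simp add: C0)
  have "fps_deriv (fps_tan (1/2)) * cos_half^2 = fps_const (1/2)"
    unfolding fps_tan_deriv by (rule dvd_div_mult_self[OF unit_imp_dvd]) (simp add: C0)
  hence d: "2 * fps_deriv (fps_tan (1/2)) * cos_half^2 = 1"
    by (simp add: fps_eq_iff numeral_fps_const mult.assoc)
  have s: "fps_sin 1 = 2 * sin_half * cos_half"
    using fps_sin_add[of "1/2" "1/2::rat"] by (simp add: algebra_simps)
  have "fps_sin 1 * fps_deriv F = 2 * (sin_half * (fps_tan (1/2) * cos_half)) + fps_X * (2 * fps_deriv (fps_tan (1/2)) * sin_half * cos_half)"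
    unfolding s F_def by (simp add: fps_deriv_mult algebra_simps)
  also have "2 * fps_deriv (fps_tan (1/2)) * sin_half * cos_half = (2 * fps_deriv (fps_tan (1/2)) * cos_half^2) * fps_tan (1/2)"
    by (subst t[symmetric]) (simp add: power2_eq_square algebra_simps)
  finally show ?thesis unfolding t d F_def by (simp add: power2_eq_square)
qed

lemma sin_power_ode:
  "fps_sin 1 * fps_deriv (sin_half^(2*k)) = of_nat (2*k) * (sin_half^(2*k) - sin_half^(2*k+2))"
proof (cases k)
  case (Suc j)
  have s: "fps_sin 1 = 2 * sin_half * cos_half"
    using fps_sin_add[of "1/2" "1/2::rat"] by (simp add: algebra_simps)
  have "fps_sin 1 * fps_deriv (sin_half^(2*k)) = sin_half * cos_half * (2 * fps_deriv (sin_half^Suc (2*j+1)))"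
    unfolding s Suc by (simp add: mult_ac del: power_Suc fps_deriv_mult)
  also have "\<dots> = of_nat (2*k) * (sin_half^(2*k) * cos_half^2)"
    unfolding double_deriv_sin_power Suc by (simp add: power2_eq_square algebra_simps)
  finally show ?thesis unfolding cos_half_squared by (simp add: algebra_simps power2_eq_square)
qed simp

text \<open>The operator \<open>sin x d/dx - 1\<close> multiplies a leading term \<open>x\<^sup>n\<close> by \<open>n - 1\<close>, hence preserves the
  order of vanishing from order 2 on.\<close>

lemma ode_coeffs_vanish:
  fixes R :: "rat fps"
  assumes "R $ 0 = 0" "R $ 1 = 0"
      and "\<And>i. i < N \<Longrightarrow> (fps_sin 1 * fps_deriv R - R) $ i = 0"
    shows "n < N \<Longrightarrow> R $ n = 0"
proof (induction n rule: less_induct)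
  case (less n)
  show ?case
  proof (cases "n < 2")
    case True thus ?thesis using assms(1,2) by (auto simp: less_2_cases_iff)
  next
    case False
    have "(fps_sin 1 * fps_deriv R) $ n = (\<Sum>i=0..n. fps_sin 1 $ i * fps_deriv R $ (n - i))"
      by (rule fps_mult_nth)
    also have "\<dots> = (\<Sum>i\<in>{1}. fps_sin 1 $ i * fps_deriv R $ (n - i))"
    proof (intro sum.mono_neutral_right ballI)
      fix i assume i: "i \<in> {0..n} - {1}"
      show "fps_sin 1 $ i * fps_deriv R $ (n - i) = 0"
      proof (cases "i = 0")
        case False
        hence "R $ Suc (n - i) = 0" using less i by (intro less.IH) auto
        thus ?thesis by simp
      qed simp
    qed (use False in auto)
    also have "\<dots> = of_nat n * R $ n" using False by simp
    finally have "(of_nat n - 1) * R $ n = 0"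
      using assms(3)[OF less.prems] by (simp add: algebra_simps)
    thus ?thesis using False by simp
  qed
qed

text \<open>This is \<open>k! (k - 1)!\<close> for positive \<open>k\<close>, written so that it vanishes at \<open>k = 0\<close>.\<close>

definition tan_coeff :: "nat \<Rightarrow> rat" where
  "tan_coeff k = of_nat k * (fact (k - 1))^2"

lemma tan_coeff_Suc: "tan_coeff (Suc k) = of_nat (Suc k) * (fact k)^2"
  by (simp add: tan_coeff_def)

lemma tan_coeff_Suc_Suc: "tan_coeff (Suc (Suc k)) = of_nat (Suc (Suc k) * Suc k) * tan_coeff (Suc k)"
  unfolding tan_coeff_Suc fact_Suc by (simp only: power2_eq_square of_nat_mult mult_ac)

text \<open>The partial sums satisfy the differential equation of \<open>x tan (x/2)\<close> up to a multiple of the next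
  power of the sine, because the contributions of neighbouring terms telescope. The remainder thus
  vanishes to the same order as that power.\<close>

lemma X_tan_half_expansion:
  assumes "n \<le> 2 * K + 1"
  shows "(fps_X * fps_tan (1/2) :: rat fps) $ n =
     (\<Sum>k=1..K. tan_coeff k * sin_even_power k $ n)"
proof -
  let ?F = "fps_X * fps_tan (1/2) :: rat fps"
  \<comment> \<open>The coefficient of the plain power \<open>sin_half ^ (2 * k)\<close>; the factor of \<open>sin_even_power\<close> is absorbed.\<close>
  define e where "e k = (4^k * tan_coeff k / fact (2*k) :: rat)" for k
  define R where "R K = ?F - (\<Sum>k=1..K. fps_const (e k) * sin_half^(2*k))" for K
  have e: "of_nat (2*k+3) * e (k+2) = of_nat (2*k+2) * e (k+1)" for k
  proof -
    have fact: "(fact (2*(k+2)) :: rat) = of_nat (2*k+3) * (of_nat (2*k+4) * fact (2*(k+1)))"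
      by (simp add: algebra_simps)
    have tan_coeff: "tan_coeff (k+2) = of_nat ((k+2)*(k+1)) * tan_coeff (k+1)"
      using tan_coeff_Suc_Suc[of k] by simp
    have cancel: "P * (4 * g * (N * A) / (P * (Q * f))) = M * (g * A / f)"
      if "P \<noteq> 0" "Q \<noteq> 0" "4 * N = Q * M" for P Q M N A f g :: rat
    proof -
      have "P * (4 * g * (N * A) / (P * (Q * f))) = 4 * N * (g * A) / (Q * f)"
        using that(1) by (simp add: mult_ac)
      thus ?thesis unfolding that(3) using that(2) by (simp add: mult.assoc)
    qed
    have "e (k+2) = 4 * 4^(k+1) * tan_coeff (k+2) / fact (2*(k+2))"
      by (simp add: e_def)
    thus ?thesis unfolding fact tan_coeff e_def
      by (simp only:) (rule cancel, simp_all add: algebra_simps del: fact_Suc)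
  qed
  have ode: "fps_sin 1 * fps_deriv (R K) - R K = fps_const (of_nat (2*K+1) * e (K+1)) * sin_half^(2*(K+1))" for K
  proof (induction K)
    case 0
    have "e 1 = 2" by (simp add: e_def tan_coeff_def fact_numeral)
    thus ?case using X_tan_half_ode by (simp add: R_def numeral_fps_const)
  next
    case (Suc K)
    have R: "R (Suc K) = R K - fps_const (e (K+1)) * sin_half^(2*(K+1))"
      by (simp add: R_def)
    have "fps_sin 1 * fps_deriv (R (Suc K)) - R (Suc K) =
       (fps_sin 1 * fps_deriv (R K) - R K) -
       fps_const (e (K+1)) * (fps_sin 1 * fps_deriv (sin_half^(2*(K+1))) - sin_half^(2*(K+1)))"
      unfolding R by (simp add: algebra_simps del: power_Suc mult_Suc_right)
    also have "\<dots> = fps_const (of_nat (2*K+2) * e (K+1)) * sin_half^(2*(K+2))"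
    proof -
      have const: "fps_const (of_nat N * c) = of_nat N * fps_const c" for N and c :: rat
        by (simp only: fps_of_nat[symmetric] fps_const_mult)
      have "of_nat N * c * X - c * (of_nat (Suc N) * (X - Y) - X) = of_nat (Suc N) * c * Y"
        for N and c X Y :: "rat fps"
        by (simp add: algebra_simps)
      from this[of "2*K+1" "fps_const (e (K+1))"] show ?thesis
        unfolding Suc.IH sin_power_ode const by (simp only: mult.assoc) simp
    qed
    also have "of_nat (2*K+2) * e (K+1) = of_nat (2 * Suc K + 1) * e (Suc K + 1)"
      using e[of K] by (simp add: algebra_simps)
    finally show ?case by simp
  qed
  have low: "(sin_half^(2*k)) $ i = 0" if "i < 2*k" for i k
    using that startsby_zero_power_prefix[of sin_half "2*k"] by simp
  have "R K $ n = 0"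
  proof (rule ode_coeffs_vanish)
    show "n < 2*K+2" using assms by simp
    show "R K $ 0 = 0"
      by (simp add: R_def fps_sum_nth low)
    show "R K $ 1 = 0"
      by (simp add: R_def fps_sum_nth low fps_tan_def)
    show "(fps_sin 1 * fps_deriv (R K) - R K) $ i = 0" if "i < 2*K+2" for i
      unfolding ode using low[of i "K+1"] that by simp
  qed
  thus ?thesis
    by (simp add: R_def fps_sum_nth sin_even_power_def e_def mult_ac)
qed

definition central_factorial :: "nat \<Rightarrow> nat \<Rightarrow> rat" where
  "central_factorial n k = fact (2*n) * sin_even_power k $ (2*n)"

lemma central_factorial_0: "central_factorial 0 k = (if k = 0 then 1 else 0)"
  by (cases k) (simp_all add: central_factorial_def sin_even_power_def fps_mult_nth)

lemma central_factorial_Suc_0: "central_factorial (Suc n) 0 = 0"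
  by (simp only: central_factorial_def sin_even_power_0) simp

lemma central_factorial_above_diagonal:
  assumes "n < k"
  shows "central_factorial n k = 0"
  using startsby_zero_power_prefix[of sin_half "2*k"] assms
  by (simp add: central_factorial_def sin_even_power_def)

lemma second_deriv_nth:
  "fact (Suc (Suc n)) * f $ Suc (Suc n) = fact n * (fps_deriv (fps_deriv f) $ n :: rat)"
proof -
  have "fact (Suc (Suc n)) = of_nat (Suc (Suc n)) * (of_nat (Suc n) * (fact n :: rat))"
    by (simp only: fact_Suc)
  thus ?thesis by (simp only: fps_deriv_nth Suc_eq_plus1 mult_ac)
qed

lemma central_factorial_Suc_Suc:
  "central_factorial (Suc n) (Suc k) =
     central_factorial n k - of_nat ((Suc k)^2) * central_factorial n (Suc k)"
proof -
  have "central_factorial (Suc n) (Suc k) =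
      fact (2*n) * (fps_deriv (fps_deriv (sin_even_power (Suc k))) $ (2*n))"
    unfolding central_factorial_def second_deriv_nth[symmetric] by simp
  thus ?thesis unfolding second_deriv_sin_even_power central_factorial_def[of n]
    by (simp only: fps_sub_nth fps_mult_left_const_nth right_diff_distrib mult.left_commute)
qed

text \<open>The action of the second derivative on the coefficients of an expansion in \<open>sin_even_power\<close>.\<close>

definition sin_shift :: "(nat \<Rightarrow> rat) \<Rightarrow> nat \<Rightarrow> rat" where
  "sin_shift a k = a (Suc k) - of_nat (k^2) * a k"

text \<open>Both sides are the \<open>2n\<close>-th derivative at \<open>0\<close> of the expansion with coefficients \<open>a\<close>; the terms
  cut off have order above \<open>2n\<close>.\<close>

lemma sum_central_factorial:
  assumes "n \<le> K"
  shows "(\<Sum>k\<le>K. a k * central_factorial n k) = (sin_shift ^^ n) a 0"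
  using assms
proof (induction n arbitrary: a)
  case 0
  show ?case by (simp add: central_factorial_0 if_distrib sum.delta cong: if_cong)
next
  case (Suc n)
  let ?T = central_factorial
  obtain L where L: "K = Suc L" using Suc.prems by (cases K) auto
  have "(\<Sum>k\<le>K. a k * ?T (Suc n) k) = (\<Sum>k\<le>L. a (Suc k) * ?T (Suc n) (Suc k))"
    unfolding L by (subst sum.atMost_Suc_shift) (simp only: central_factorial_Suc_0 mult_zero_right add_0)
  also have "\<dots> = (\<Sum>k\<le>L. a (Suc k) * ?T n k) - (\<Sum>k\<le>L. of_nat ((Suc k)^2) * a (Suc k) * ?T n (Suc k))"
    unfolding central_factorial_Suc_Suc by (simp only: right_diff_distrib sum_subtractf mult_ac)
  also have "(\<Sum>k\<le>L. a (Suc k) * ?T n k) = (\<Sum>k\<le>K. a (Suc k) * ?T n k)"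
    using central_factorial_above_diagonal[of n K] Suc.prems unfolding L by simp
  also have "(\<Sum>k\<le>L. of_nat ((Suc k)^2) * a (Suc k) * ?T n (Suc k)) = (\<Sum>k\<le>K. of_nat (k^2) * a k * ?T n k)"
    unfolding L by (subst sum.atMost_Suc_shift) simp
  also have "(\<Sum>k\<le>K. a (Suc k) * ?T n k) - (\<Sum>k\<le>K. of_nat (k^2) * a k * ?T n k) = (\<Sum>k\<le>K. sin_shift a k * ?T n k)"
    by (simp only: sin_shift_def sum_subtractf[symmetric] left_diff_distrib)
  also have "\<dots> = (sin_shift ^^ Suc n) a 0"
    using Suc by (simp add: funpow_swap1)
  finally show ?case .
qed

definition gandhi_step :: "('a::comm_ring_1 \<Rightarrow> 'a) \<Rightarrow> 'a \<Rightarrow> 'a" where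
  "gandhi_step b x = (x + 1)^2 * b (x + 1) - x^2 * b x"

lemma sin_shift_tan_coeff: "sin_shift tan_coeff k = (fact k)^2"
  by (cases k) (simp_all add: sin_shift_def tan_coeff_def power2_eq_square algebra_simps)

text \<open>Writing the coefficients as multiples of \<open>(k!)\<^sup>2\<close> turns the shift into Gandhi's recursion.\<close>

lemma sin_shift_gandhi: "sin_shift (\<lambda>k. (fact k)^2 * b (of_nat k)) = (\<lambda>k. (fact k)^2 * gandhi_step b (of_nat k))"
  by (rule ext) (simp add: sin_shift_def gandhi_step_def power2_eq_square algebra_simps)

text \<open>The first shift takes \<open>k! (k - 1)!\<close> to \<open>(k!)\<^sup>2\<close>, the starting point of Gandhi's recursion; the
  remaining \<open>n\<close> shifts are its steps.\<close>

lemma genocchi_gandhi: "genocchi (2 * Suc n) = (gandhi_step ^^ n) (\<lambda>_. 1) 0"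
proof -
  have it: "(sin_shift ^^ Suc n) tan_coeff = (\<lambda>k. (fact k)^2 * (gandhi_step ^^ n) (\<lambda>_. 1) (of_nat k))"
  proof (induction n)
    case 0
    show ?case by (auto simp: sin_shift_tan_coeff)
  next
    case (Suc n)
    show ?case using sin_shift_gandhi by (simp add: Suc.IH[simplified])
  qed
  have "genocchi (2 * Suc n) = (\<Sum>k=1..Suc n. tan_coeff k * central_factorial (Suc n) k)"
    unfolding genocchi_def
    by (subst X_tan_half_expansion[where K = "Suc n"])
       (simp, simp only: sum_distrib_left central_factorial_def mult.left_commute)
  also have "\<dots> = (\<Sum>k\<le>Suc n. tan_coeff k * central_factorial (Suc n) k)"
    by (rule sum.mono_neutral_left) (auto simp: tan_coeff_def)
  also have "\<dots> = (gandhi_step ^^ n) (\<lambda>_. 1) 0"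
    unfolding sum_central_factorial[OF order_refl] it by simp
  finally show ?thesis .
qed

section \<open>Counting single cycles\<close>

text \<open>One odd and one even step of \<open>transfer\<close> combined.\<close>

definition genocchi_step :: "(int poly \<Rightarrow> int poly) \<Rightarrow> int poly \<Rightarrow> int poly" where
  "genocchi_step f x = x * ((x + 1) * f (x + 1) - (x - zvar) * f x)"

lemma transfer_even: "transfer (2 * n) f = (genocchi_step ^^ n) f zvar"
proof (induction n arbitrary: f)
  case (Suc n)
  have "transfer (2 * Suc n) f = transfer (2 * n) (genocchi_step f)"
    by (simp add: genocchi_step_def[abs_def] algebra_simps)
  thus ?case by (simp add: Suc.IH funpow_swap1)
qed simp

text \<open>Evaluation at \<open>0\<close> is the substitution of \<open>0\<close> for \<open>zvar\<close>. After the factor \<open>x\<close> has been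
  split off, this substitution maps the iteration to Gandhi's recursion.\<close>

lemma genocchi_step_iterate:
  "\<exists>r. (\<forall>x. (genocchi_step ^^ Suc n) (\<lambda>_. 1) x = x * r x) \<and>
       (\<forall>x. poly (r x) 0 = (gandhi_step ^^ n) (\<lambda>_. 1) (poly x 0))"
proof (induction n)
  case 0
  show ?case
    by (rule exI[of _ "\<lambda>_. 1 + zvar"]) (simp add: genocchi_step_def poly_monom algebra_simps)
next
  case (Suc n)
  then obtain r where r: "\<And>x. (genocchi_step ^^ Suc n) (\<lambda>_. 1) x = x * r x"
    "\<And>x. poly (r x) 0 = (gandhi_step ^^ n) (\<lambda>_. 1) (poly x 0)" by blast
  let ?r = "\<lambda>x. (x + 1)^2 * r (x + 1) - (x - zvar) * (x * r x)"
  have "(genocchi_step ^^ Suc (Suc n)) (\<lambda>_. 1) x = x * ?r x" for x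
    unfolding funpow.simps(2)[of "Suc n"] comp_apply genocchi_step_def[of "(genocchi_step ^^ Suc n) _"] r(1)
    by (simp add: power2_eq_square algebra_simps)
  moreover have "poly (?r x) 0 = (gandhi_step ^^ Suc n) (\<lambda>_. 1) (poly x 0)" for x
    by (simp add: r(2) gandhi_step_def poly_monom power2_eq_square)
  ultimately show ?case by (intro exI[of _ ?r] conjI allI)
qed

lemma gandhi_iterate_of_int:
  "(gandhi_step ^^ n) (\<lambda>_. 1) (of_int x) = of_int ((gandhi_step ^^ n) (\<lambda>_. 1) x)"
proof (induction n arbitrary: x)
  case (Suc n)
  have "gandhi_step f (of_int x) = of_int (gandhi_step g x)"
    if "\<And>x. f (of_int x) = of_int (g x)" for f :: "'a \<Rightarrow> 'a" and g x
    using that[of "x + 1"] that[of x] by (simp add: gandhi_step_def)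
  thus ?case using Suc.IH by simp
qed simp

text \<open>At \<open>x = zvar\<close> the factor \<open>x\<close> of the iterate becomes \<open>zvar\<close>, so its linear coefficient is the
  constant term of the cofactor.\<close>

lemma coeff_path_weight:
  assumes "n \<ge> 1"
  shows "of_int (coeff (path_weight (2 * n) 0) 1) = genocchi (2 * n)"
proof -
  obtain k where k: "n = Suc k" using assms by (cases n) auto
  obtain r where r: "\<And>x. (genocchi_step ^^ Suc k) (\<lambda>_. 1) x = x * r x"
    "\<And>x. poly (r x) 0 = (gandhi_step ^^ k) (\<lambda>_. 1) (poly x 0)"
    using genocchi_step_iterate by blast
  have "path_weight (2 * n) 0 = zvar * r zvar"
    unfolding path_weight_transfer transfer_even k r(1)[symmetric]
    by (simp add: shifted_falling_def[abs_def])
  hence "coeff (path_weight (2 * n) 0) 1 = poly (r zvar) 0"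
    by (simp add: coeff_monom_mult poly_0_coeff_0)
  also have "\<dots> = (gandhi_step ^^ k) (\<lambda>_. 1) 0"
    by (simp add: r(2) poly_monom)
  finally show ?thesis
    using gandhi_iterate_of_int[of k 0, where 'a = rat] by (simp add: genocchi_gandhi k del: mult_Suc_right)
qed

lemma cyc_eq_1_iff:
  assumes "\<sigma> permutes S" "finite S" "S \<noteq> {}"
  shows "cyc S \<sigma> = 1 \<longleftrightarrow> cyclic_on \<sigma> S"
proof
  have perm: "permutation \<sigma>" using assms unfolding permutation_permutes by blast
  assume "cyc S \<sigma> = 1"
  then obtain C where C: "orbit \<sigma> ` S = {C}" unfolding cyc_def by (auto simp: card_1_singleton_iff)
  have orbit: "orbit \<sigma> x = C" if "x \<in> S" for x
    using C that by auto
  have "S \<subseteq> C"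
    using orbit permutation_self_in_orbit[OF perm] by auto
  moreover obtain x where "x \<in> S"
    using assms(3) by auto
  hence "C \<subseteq> S"
    using orbit permutes_orbit_subset[OF assms(1)] by auto
  ultimately show "cyclic_on \<sigma> S"
    using orbit \<open>x \<in> S\<close> by (intro cyclic_on_singleI) auto
next
  assume "cyclic_on \<sigma> S"
  hence "orbit \<sigma> ` S = (\<lambda>_. S) ` S"
    using orbit_cyclic_eq3[OF \<open>cyclic_on \<sigma> S\<close>] by (intro image_cong refl) simp
  also have "\<dots> = {S}"
    using assms(3) by (simp add: image_constant_conv)
  finally have "orbit \<sigma> ` S = {S}" .
  thus "cyc S \<sigma> = 1" by (simp add: cyc_def)
qed

lemma card_cyclic_eq_coeff:
  assumes "finite S" "S \<noteq> {}" "\<And>\<sigma>. \<sigma> \<in> P \<Longrightarrow> \<sigma> permutes S"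
  shows "int (card {\<sigma> \<in> P. cyclic_on \<sigma> S}) = coeff (\<Sum>\<sigma>\<in>P. monom 1 (cyc S \<sigma>)) 1"
proof -
  have "finite P"
    using finite_subset[OF _ finite_permutations[OF assms(1)]] assms(3) by blast
  moreover have "{\<sigma> \<in> P. cyclic_on \<sigma> S} = {\<sigma> \<in> P. cyc S \<sigma> = 1}"
    using cyc_eq_1_iff assms by blast
  ultimately show ?thesis by (simp add: coeff_sum coeff_monom sum.If_cases Int_def)
qed

theorem theorem9:
  fixes n :: nat
  assumes "n \<ge> 1"
  shows "(\<Sum>\<sigma>\<in>E_permutations n. monom 1 (cyc {1..2*n} \<sigma>)) =
           (\<Sum>\<sigma>\<in>D_permutations n. monom 1 (cyc {1..2*n} \<sigma>) :: int poly) \<and>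
         card (E_cycles n) = card (D_cycles n) \<and>
         of_nat (card (D_cycles n)) = genocchi (2*n)"
proof -
  have D: "int (card (D_cycles n)) = coeff (path_weight (2*n) 0) 1"
    unfolding D_cycles_def D_permutations_path_weight[symmetric]
    by (rule card_cyclic_eq_coeff) (use assms in \<open>auto simp: D_permutations_def\<close>)
  have E: "int (card (E_cycles n)) = coeff (path_weight (2*n) 0) 1"
    unfolding E_cycles_def E_permutations_path_weight[symmetric]
    by (rule card_cyclic_eq_coeff) (use assms in \<open>auto simp: E_permutations_def\<close>)
  have "card (E_cycles n) = card (D_cycles n)"
    using D E by linarith
  moreover have "of_nat (card (D_cycles n)) = genocchi (2*n)"
    using coeff_path_weight[OF assms] unfolding D[symmetric] by simp
  ultimately show ?thesis
    unfolding D_permutations_path_weight E_permutations_path_weight by blast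
qed

end
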